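(* For $n$ even with $n\ge4$, \[\operatorname{gon}(H_{3,n})=\begin{cases}3,& n\le 6,\\ 4,& n\ge 8.\end{cases}\]
   Context: For $n\ge4$ even, the Harary graph $H_{3,n}$ is the circulant graph $\mathrm{Ci}_n(\{1,n/2\})$: vertices $v_1,\ldots,v_n$ arranged in a cycle, with $v_i$ adjacent to $v_m$ iff $|i-m|\bmod n\in\{1,n/2\}$. For a connected loopless multigraph $G$: a divisor is a function $D:V(G)\to\mathbb{Z}$; effective if all values are $\ge0$; degree $\sum_vD(v)$. Firing a vertex $v$ moves one chip from $v$ along each incident edge; divisors are equivalent if related by a sequence of firings. $D$ has positive rank if for every vertex $q$, $D-q$ is equivalent to an effective divisor. $\operatorname{gon}(G)$ is the minimum degree of a positive rank divisor. *)

theory Defs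
  imports "HOL-Number_Theory.Cong" "HOL-Library.Multiset"
begin

text \<open>A loopless multigraph is given by its vertices and the multiset of its edges, each edge
  being the two-element set of its endpoints; parallel edges are counted by multiplicity.\<close>

record 'a multigraph =
  verts :: "'a set"
  edges :: "'a set multiset"

definition adj :: "'a multigraph \<Rightarrow> 'a \<Rightarrow> 'a \<Rightarrow> bool" where
  "adj G u v \<longleftrightarrow> {u, v} \<in># edges G"

locale connected_loopless_multigraph =
  fixes G :: "'a multigraph"
  assumes finite_verts: "finite (verts G)"
    and verts_nonempty: "verts G \<noteq> {}"
    and edges_wf: "\<And>e. e \<in># edges G \<Longrightarrow> e \<subseteq> verts G \<and> card e = 2"
    and connected: "\<And>u v. u \<in> verts G \<Longrightarrow> v \<in> verts G \<Longrightarrow> (adj G)\<^sup>*\<^sup>* u v"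

text \<open>Divisors are total functions of which only the values on the vertices matter: on a
  loopless multigraph, firing a vertex leaves all values outside the vertex set unchanged.\<close>

type_synonym 'a divisor = "'a \<Rightarrow> int"

definition divisor_degree :: "'a multigraph \<Rightarrow> 'a divisor \<Rightarrow> int" where
  "divisor_degree G D = (\<Sum>v\<in>verts G. D v)"

definition effective :: "'a multigraph \<Rightarrow> 'a divisor \<Rightarrow> bool" where
  "effective G D \<longleftrightarrow> (\<forall>v\<in>verts G. D v \<ge> 0)"

definition fire :: "'a multigraph \<Rightarrow> 'a \<Rightarrow> 'a divisor \<Rightarrow> 'a divisor" where
  "fire G v D = (\<lambda>u. if u = v then D v - int (size {#e \<in># edges G. v \<in> e#})
                     else D u + int (count (edges G) {u, v}))"

definition fires_to :: "'a multigraph \<Rightarrow> 'a divisor \<Rightarrow> 'a divisor \<Rightarrow> bool" where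
  "fires_to G D D' \<longleftrightarrow> (\<exists>v\<in>verts G. D' = fire G v D)"

text \<open>This relation is symmetric, because firing every vertex exactly once restores the original
  divisor; see \<open>equivalent_sym\<close> below.\<close>

definition equivalent :: "'a multigraph \<Rightarrow> 'a divisor \<Rightarrow> 'a divisor \<Rightarrow> bool" where
  "equivalent G = (fires_to G)\<^sup>*\<^sup>*"

definition positive_rank :: "'a multigraph \<Rightarrow> 'a divisor \<Rightarrow> bool" where
  "positive_rank G D \<longleftrightarrow>
     (\<forall>q\<in>verts G. \<exists>E. effective G E \<and> equivalent G (D(q := D q - 1)) E)"

definition gonality :: "'a multigraph \<Rightarrow> int" where
  "gonality G = (LEAST d. \<exists>D. positive_rank G D \<and> divisor_degree G D = d)"

text \<open>The circulant graph on the vertices \<open>1, \<dots>, n\<close>. As edges are unordered pairs, this joins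
  vertices whose difference is congruent to \<open>s\<close> or to \<open>- s\<close> modulo \<open>n\<close>, for some \<open>s\<close> in \<open>S\<close>.
  The graph is simple: an offset \<open>s\<close> with \<open>2 * s = n\<close> gives a single edge, not a double one.\<close>

definition circulant :: "nat \<Rightarrow> nat set \<Rightarrow> nat multigraph" where
  "circulant n S = \<lparr>verts = {1..n},
     edges = mset_set {{i, m} | i m. i \<in> {1..n} \<and> m \<in> {1..n} \<and> (\<exists>s\<in>S. [m = i + s] (mod n))}\<rparr>"

definition harary3 :: "nat \<Rightarrow> nat multigraph" where
  "harary3 n = circulant n {1, n div 2}"


lemma (in connected_loopless_multigraph) degree_eq_sum_count:
  assumes "u \<in> verts G"
  shows "size {#e \<in># edges G. u \<in> e#} = (\<Sum>v\<in>verts G - {u}. count (edges G) {u, v})"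
proof -
  let ?I = "(\<lambda>v. {u, v}) ` (verts G - {u})"
  have sub: "set_mset {#e \<in># edges G. u \<in> e#} \<subseteq> ?I"
  proof
    fix e assume "e \<in> set_mset {#e \<in># edges G. u \<in> e#}"
    then have e: "e \<in># edges G" "u \<in> e" by auto
    then obtain x y where "e = {x, y}" "x \<noteq> y"
      using edges_wf card_2_iff by metis
    then show "e \<in> ?I" using e edges_wf[OF e(1)] by auto
  qed
  have "size {#e \<in># edges G. u \<in> e#} = (\<Sum>e\<in>?I. count {#e \<in># edges G. u \<in> e#} e)"
    unfolding size_multiset_overloaded_eq
    by (rule sum.mono_neutral_left) (use sub finite_verts in \<open>auto simp: not_in_iff\<close>)
  also have "\<dots> = (\<Sum>v\<in>verts G - {u}. count {#e \<in># edges G. u \<in> e#} {u, v})"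
    by (subst sum.reindex) (auto simp: inj_on_def doubleton_eq_iff)
  finally show ?thesis by simp
qed

lemma (in connected_loopless_multigraph) fire_all:
  assumes "distinct vs" "set vs = verts G"
  shows "fold (fire G) vs D = D"
proof
  fix u
  have gen: "distinct xs \<Longrightarrow> set xs \<subseteq> verts G \<Longrightarrow> fold (fire G) xs D u =
      D u - (if u \<in> set xs then int (size {#e \<in># edges G. u \<in> e#}) else 0)
          + (\<Sum>v\<in>set xs - {u}. int (count (edges G) {u, v}))" for xs
  proof (induction xs rule: rev_induct)
    case (snoc x xs)
    have "set (xs @ [x]) - {u} = (if x = u then set xs - {u} else insert x (set xs - {u}))"
      by auto
    then show ?case using snoc by (auto simp: fire_def)
  qed simp
  show "fold (fire G) vs D u = D u"
  proof (cases "u \<in> verts G")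
    case True
    then show ?thesis using gen[of vs] assms degree_eq_sum_count[OF True] by simp
  next
    case False
    then have "count (edges G) {u, v} = 0" for v
      using edges_wf[of "{u, v}"] by (auto simp: count_eq_zero_iff)
    then show ?thesis using gen[of vs] assms False by simp
  qed
qed

lemma (in connected_loopless_multigraph) equivalent_sym:
  assumes "equivalent G D D'" shows "equivalent G D' D"
proof -
  have fold_equiv: "set xs \<subseteq> verts G \<Longrightarrow> equivalent G E (fold (fire G) xs E)" for xs E
  proof (induction xs arbitrary: E)
    case (Cons x xs)
    then have "fires_to G E (fire G x E)" "equivalent G (fire G x E) (fold (fire G) xs (fire G x E))"
      by (auto simp: fires_to_def)
    then show ?case
      unfolding equivalent_def by (simp add: converse_rtranclp_into_rtranclp)
  qed (simp add: equivalent_def)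
  have unfire: "equivalent G (fire G v E) E" if v: "v \<in> verts G" for v E
  proof -
    obtain xs where xs: "set xs = verts G - {v}" "distinct xs"
      using finite_distinct_list[of "verts G - {v}"] finite_verts by auto
    have "fold (fire G) (v # xs) E = E"
      by (rule fire_all) (use xs v in auto)
    then show ?thesis using fold_equiv[of xs "fire G v E"] xs by auto
  qed
  show ?thesis using assms unfolding equivalent_def
  proof (induction rule: rtranclp_induct)
    case (step y z)
    from step.hyps(2) obtain v where "v \<in> verts G" "z = fire G v y"
      by (auto simp: fires_to_def)
    then have "(fires_to G)\<^sup>*\<^sup>* z y"
      using unfire[of v y] by (simp add: equivalent_def)
    then show ?case using step.IH by (rule rtranclp_trans)
  qed simp
qed

lemma adj_harary3_iff:
  assumes "even n" "n \<ge> 4" "i \<in> {1..n}" "m \<in> {1..n}"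
  shows "adj (harary3 n) i m \<longleftrightarrow> nat \<bar>int i - int m\<bar> \<in> {1, n - 1, n div 2}"
proof -
  let ?R = "\<lambda>i m. \<exists>s\<in>{1, n div 2}. [m = i + s] (mod n)"
  have fin: "finite {{i, m} | i m. i \<in> {1..n} \<and> m \<in> {1..n} \<and> ?R i m}"
    by (rule finite_subset[of _ "Pow {1..n}"]) auto
  have "adj (harary3 n) i m \<longleftrightarrow> ?R i m \<or> ?R m i"
    unfolding adj_def harary3_def circulant_def
    using fin assms by (auto simp: doubleton_eq_iff)
  moreover have R: "[y = x + s] (mod n) \<longleftrightarrow> y = x + s \<or> y + n = x + s"
    if "x \<in> {1..n}" "y \<in> {1..n}" "0 < s" "s < n" for x y s
  proof
    assume *: "[y = x + s] (mod n)"
    show "y = x + s \<or> y + n = x + s"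
    proof (cases "x + s \<ge> y")
      case True
      then obtain k where k: "x + s = y + k * n"
        using cong_le_nat[of y "x + s" n] cong_sym[OF *] by (auto simp: add.commute)
      have "k < 2"
      proof (rule ccontr)
        assume "\<not> k < 2"
        then have "2 * n \<le> k * n" by (intro mult_le_mono1) simp
        then show False using k that unfolding atLeastAtMost_iff by linarith
      qed
      then have "k = 0 \<or> k = 1" by auto
      then show ?thesis using k by auto
    next
      case False
      then obtain k where k: "y = x + s + k * n"
        using cong_le_nat[of "x + s" y n] * by auto
      then have "k = 0" using that by (cases k) auto
      then show ?thesis using k by auto
    qed
  next
    assume "y = x + s \<or> y + n = x + s"
    then show "[y = x + s] (mod n)"
      unfolding cong_def by (metis mod_add_self2)
  qed
  moreover obtain h where h: "n = 2 * h" "h \<ge> 2" using assms(1,2) by (auto elim!: evenE)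
  moreover have dist: "nat \<bar>int i - int m\<bar> = (if i \<le> m then m - i else i - m)"
    by auto
  ultimately have "adj (harary3 n) i m \<longleftrightarrow>
      (m = i + 1 \<or> m + n = i + 1) \<or> (m = i + h \<or> m + n = i + h) \<or>
      (i = m + 1 \<or> i + n = m + 1) \<or> (i = m + h \<or> i + n = m + h)"
    using R[of i m 1] R[of i m h] R[of m i 1] R[of m i h] assms(3,4) by simp
  also have "\<dots> \<longleftrightarrow> nat \<bar>int i - int m\<bar> \<in> {1, n - 1, h}"
  proof (cases "i \<le> m")
    case True
    then obtain d where "m = i + d" using le_Suc_ex by blast
    then show ?thesis unfolding dist using h assms(3,4) by auto
  next
    case False
    then obtain d where "i = m + d" using le_Suc_ex nat_le_linear by blast
    then show ?thesis unfolding dist using h assms(3,4) False by auto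
  qed
  finally show ?thesis using h by simp
qed

lemma connected_loopless_harary3:
  assumes "even n" "n \<ge> 4"
  shows "connected_loopless_multigraph (harary3 n)"
proof
  show "finite (verts (harary3 n))" "verts (harary3 n) \<noteq> {}"
    using assms by (auto simp: harary3_def circulant_def)
next
  fix e assume e: "e \<in># edges (harary3 n)"
  let ?A = "{{i, m} | i m. i \<in> {1..n} \<and> m \<in> {1..n} \<and> (\<exists>s\<in>{1, n div 2}. [m = i + s] (mod n))}"
  have "finite ?A" by (rule finite_subset[of _ "Pow {1..n}"]) auto
  then have "e \<in> ?A" using e by (simp add: harary3_def circulant_def)
  then obtain i m where im: "e = {i, m}" "i \<in> {1..n}" "m \<in> {1..n}" by blast
  then have "adj (harary3 n) i m" using e by (simp add: adj_def)
  then have "i \<noteq> m" using adj_harary3_iff[OF assms im(2,3)] assms by auto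
  then show "e \<subseteq> verts (harary3 n) \<and> card e = 2"
    using im by (simp add: harary3_def circulant_def)
next
  fix u v assume "u \<in> verts (harary3 n)" "v \<in> verts (harary3 n)"
  then have uv: "u \<in> {1..n}" "v \<in> {1..n}" by (auto simp: harary3_def circulant_def)
  have sym: "adj (harary3 n) x y \<Longrightarrow> adj (harary3 n) y x" for x y
    by (simp add: adj_def insert_commute)
  have "k < n \<Longrightarrow> (adj (harary3 n))\<^sup>*\<^sup>* 1 (Suc k)" for k
  proof (induction k)
    case (Suc k)
    then have "adj (harary3 n) (Suc k) (Suc (Suc k))"
      using adj_harary3_iff[OF assms] by auto
    then show ?case using Suc by (meson Suc_lessD rtranclp.rtrancl_into_rtrancl)
  qed simp
  then have one: "(adj (harary3 n))\<^sup>*\<^sup>* 1 x" if "x \<in> {1..n}" for x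
    using that by (cases x) auto
  have "symp (adj (harary3 n))" using sym by (rule sympI)
  then have "(adj (harary3 n))\<^sup>*\<^sup>* u 1" using one[OF uv(1)]
    by (metis symp_rtranclp sympD)
  then show "(adj (harary3 n))\<^sup>*\<^sup>* u v" using one[OF uv(2)] by (rule rtranclp_trans)
qed

end

theory Submission
  imports Defs
begin

text \<open>Equivalence means \<open>E = D - L f\<close> for the Laplacian \<open>L\<close> and some integer script \<open>f\<close>. If \<open>D\<close> and
  \<open>E\<close> are effective, the set on which \<open>f\<close> is maximal has an edge cut of size at most \<open>deg D\<close>.
  In \<open>H_{3,n}\<close> a cut of size at most \<open>3\<close> isolates a single vertex. Hence an effective divisor of
  degree at most \<open>2\<close> is equivalent to no other effective divisor, and one of degree \<open>3\<close> only if it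
  is \<open>3 v\<close> or the neighbourhood of \<open>v\<close>; for \<open>n \<ge> 8\<close> the neighbourhood determines \<open>v\<close>, so these
  two divisors together reach only four vertices. For \<open>n \<le> 6\<close> non-adjacent vertices have equal
  neighbourhoods, whose three chips therefore reach every vertex; for \<open>n \<ge> 8\<close> four chips sweep
  the graph as a pair of rungs.\<close>

section \<open>Firing scripts and the graph Laplacian\<close>

definition laplacian :: "'a multigraph \<Rightarrow> ('a \<Rightarrow> int) \<Rightarrow> 'a \<Rightarrow> int" where
  "laplacian G f u = (\<Sum>v\<in>verts G. int (count (edges G) {u, v}) * (f u - f v))"

definition cut_size :: "'a multigraph \<Rightarrow> 'a set \<Rightarrow> nat" where
  "cut_size G U = (\<Sum>u\<in>U. \<Sum>w\<in>verts G - U. count (edges G) {u, w})"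

lemma laplacian_add: "laplacian G (\<lambda>v. f v + g v) u = laplacian G f u + laplacian G g u"
  by (simp add: laplacian_def sum.distrib[symmetric] algebra_simps)

lemma laplacian_diff: "laplacian G (\<lambda>v. f v - g v) u = laplacian G f u - laplacian G g u"
  by (simp add: laplacian_def sum_subtractf[symmetric] algebra_simps)

lemma laplacian_uminus: "laplacian G (\<lambda>v. - f v) u = - laplacian G f u"
  by (simp add: laplacian_def sum_negf[symmetric] algebra_simps)

context connected_loopless_multigraph
begin

lemma count_edges_same [simp]: "count (edges G) {u} = 0"
  using edges_wf[of "{u}"] by (auto simp: count_eq_zero_iff)

lemma count_edges_outside: "u \<notin> verts G \<Longrightarrow> count (edges G) {u, v} = 0"
  using edges_wf[of "{u, v}"] by (auto simp: count_eq_zero_iff)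

lemma laplacian_of_bool:
  assumes "v \<in> verts G"
  shows "laplacian G (\<lambda>x. of_bool (x = v)) u =
    (if u = v then int (size {#e \<in># edges G. v \<in> e#}) else - int (count (edges G) {u, v}))"
proof (cases "u = v")
  case True
  have "laplacian G (\<lambda>x. of_bool (x = v)) v
      = (\<Sum>x\<in>verts G - {v}. int (count (edges G) {v, x}))"
    unfolding laplacian_def using finite_verts
    by (intro sum.mono_neutral_cong_right) auto
  then show ?thesis using True degree_eq_sum_count[OF assms] by simp
next
  case False
  have "laplacian G (\<lambda>x. of_bool (x = v)) u = (\<Sum>x\<in>{v}. - int (count (edges G) {u, x}))"
    unfolding laplacian_def using finite_verts assms False
    by (intro sum.mono_neutral_cong_right) auto
  then show ?thesis using False by simp
qed

lemma fire_eq_laplacian: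
  assumes "v \<in> verts G"
  shows "fire G v D = (\<lambda>u. D u - laplacian G (\<lambda>x. of_bool (x = v)) u)"
  by (auto simp: fire_def laplacian_of_bool[OF assms])

text \<open>The order of firings is immaterial: a vertex with positive count is fired first, and
  induction on the total number of firings deals with the rest.\<close>

lemma equivalent_laplacian_nat:
  fixes g :: "'a \<Rightarrow> nat"
  shows "equivalent G D (\<lambda>u. D u - laplacian G (\<lambda>x. int (g x)) u)"
proof (induction "sum g (verts G)" arbitrary: g D)
  case 0
  then have "laplacian G (\<lambda>x. int (g x)) u = 0" for u
    using finite_verts count_edges_outside[of u]
    by (cases "u \<in> verts G") (auto simp: laplacian_def intro!: sum.neutral)
  then show ?case by (simp add: equivalent_def)
next
  case (Suc k)
  then obtain v where v: "v \<in> verts G" "g v > 0"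
    by (metis gr0I nat.distinct(1) sum.neutral)
  define h where "h = g(v := g v - 1)"
  have split: "(\<lambda>x. int (g x)) = (\<lambda>x. of_bool (x = v) + int (h x))"
    using v by (auto simp: h_def)
  have "sum g (verts G) = g v + sum g (verts G - {v})"
    "sum h (verts G) = h v + sum h (verts G - {v})"
    using v finite_verts by (auto intro: sum.remove)
  moreover have "sum h (verts G - {v}) = sum g (verts G - {v})"
    by (rule sum.cong) (auto simp: h_def)
  ultimately have "k = sum h (verts G)"
    using Suc.hyps(2) v by (simp add: h_def)
  then have "equivalent G (fire G v D) (\<lambda>u. fire G v D u - laplacian G (\<lambda>x. int (h x)) u)"
    by (rule Suc.hyps(1))
  moreover have "fires_to G D (fire G v D)" using v by (auto simp: fires_to_def)
  moreover have "(\<lambda>u. fire G v D u - laplacian G (\<lambda>x. int (h x)) u)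
      = (\<lambda>u. D u - laplacian G (\<lambda>x. int (g x)) u)"
    unfolding split laplacian_add fire_eq_laplacian[OF v(1)] by (simp add: algebra_simps)
  ultimately show ?case unfolding equivalent_def
    by (simp add: converse_rtranclp_into_rtranclp)
qed

text \<open>Adding a constant to a script does not change its Laplacian, so subtracting the minimum
  \<open>c\<close> makes all counts on the vertices nonnegative. The truncation by
  \<open>nat\<close> outside the vertex set is harmless.\<close>

lemma equivalent_laplacian: "equivalent G D (\<lambda>u. D u - laplacian G f u)"
proof -
  define c where "c = Min (f ` verts G)"
  have eq: "laplacian G f u = laplacian G (\<lambda>x. int (nat (f x - c))) u" for u
  proof (cases "u \<in> verts G")
    case True
    have "c \<le> f x" if "x \<in> verts G" for x
      using that finite_verts by (simp add: c_def)
    then show ?thesis using True by (auto simp: laplacian_def intro!: sum.cong)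
  next
    case False
    then show ?thesis by (simp add: laplacian_def count_edges_outside)
  qed
  show ?thesis unfolding eq by (rule equivalent_laplacian_nat)
qed

lemma equivalent_iff_laplacian:
  "equivalent G D E \<longleftrightarrow> (\<exists>f. E = (\<lambda>u. D u - laplacian G f u))"
proof
  assume "equivalent G D E"
  then show "\<exists>f. E = (\<lambda>u. D u - laplacian G f u)"
    unfolding equivalent_def
  proof (induction rule: rtranclp_induct)
    case base
    have "D = (\<lambda>u. D u - laplacian G (\<lambda>_. 0) u)" by (simp add: laplacian_def)
    then show ?case by blast
  next
    case (step E F)
    then obtain f v where fv: "E = (\<lambda>u. D u - laplacian G f u)" "v \<in> verts G" "F = fire G v E"
      by (auto simp: fires_to_def)
    have "F = (\<lambda>u. D u - laplacian G (\<lambda>x. f x + of_bool (x = v)) u)"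
      unfolding laplacian_add fv(3) fire_eq_laplacian[OF fv(2)] by (simp add: fv(1) algebra_simps)
    then show ?case by blast
  qed
qed (auto simp: equivalent_laplacian)

text \<open>The chip removed at \<open>q\<close> moves to the other side of the inequality, so the
  existence of \<open>E\<close> becomes a single condition on a script.\<close>

lemma positive_rank_iff:
  "positive_rank G D \<longleftrightarrow>
    (\<forall>q\<in>verts G. \<exists>f. \<forall>u\<in>verts G. of_bool (u = q) \<le> D u - laplacian G f u)"
proof -
  have "(\<exists>E. effective G E \<and> equivalent G (D(q := D q - 1)) E) \<longleftrightarrow>
      (\<exists>f. \<forall>u\<in>verts G. of_bool (u = q) \<le> D u - laplacian G f u)" for q
  proof -
    have "(\<exists>E. effective G E \<and> equivalent G (D(q := D q - 1)) E) \<longleftrightarrow>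
        (\<exists>f. effective G (\<lambda>u. (D(q := D q - 1)) u - laplacian G f u))"
      unfolding equivalent_iff_laplacian by blast
    also have "\<dots> \<longleftrightarrow> (\<exists>f. \<forall>u\<in>verts G. of_bool (u = q) \<le> D u - laplacian G f u)"
      by (intro ex_cong1) (auto simp: effective_def)
    finally show ?thesis .
  qed
  then show ?thesis by (simp add: positive_rank_def)
qed

lemma positive_rank_laplacian:
  assumes "positive_rank G D"
  shows "positive_rank G (\<lambda>u. D u - laplacian G f u)"
  unfolding positive_rank_iff
proof
  fix q assume "q \<in> verts G"
  then obtain g where "\<forall>u\<in>verts G. of_bool (u = q) \<le> D u - laplacian G g u"
    using assms unfolding positive_rank_iff by blast
  then show "\<exists>g. \<forall>u\<in>verts G. of_bool (u = q) \<le> D u - laplacian G f u - laplacian G g u"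
    by (intro exI[of _ "\<lambda>x. g x - f x"]) (simp add: laplacian_diff)
qed

lemma positive_rank_cong:
  assumes "\<And>u. u \<in> verts G \<Longrightarrow> D u = E u"
  shows "positive_rank G D \<longleftrightarrow> positive_rank G E"
  unfolding positive_rank_iff using assms by (simp cong: ball_cong)

text \<open>Each edge contributes opposite amounts at its two endpoints. Hence equivalent divisors
  have equal degree.\<close>

lemma sum_laplacian: "(\<Sum>u\<in>verts G. laplacian G f u) = 0"
proof -
  have "(\<Sum>u\<in>verts G. laplacian G f u)
      = (\<Sum>u\<in>verts G. \<Sum>v\<in>verts G. int (count (edges G) {u, v}) * f u)
      - (\<Sum>u\<in>verts G. \<Sum>v\<in>verts G. int (count (edges G) {u, v}) * f v)"
    by (simp add: laplacian_def right_diff_distrib sum_subtractf)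
  also have "(\<Sum>u\<in>verts G. \<Sum>v\<in>verts G. int (count (edges G) {u, v}) * f v)
      = (\<Sum>v\<in>verts G. \<Sum>u\<in>verts G. int (count (edges G) {u, v}) * f v)"
    by (rule sum.swap)
  also have "\<dots> = (\<Sum>v\<in>verts G. \<Sum>u\<in>verts G. int (count (edges G) {v, u}) * f v)"
    by (simp add: insert_commute)
  finally show ?thesis by simp
qed

lemma divisor_degree_laplacian:
  "divisor_degree G (\<lambda>u. D u - laplacian G f u) = divisor_degree G D"
  by (simp add: divisor_degree_def sum_subtractf sum_laplacian)

lemma positive_rank_obtain_effective:
  assumes "positive_rank G D"
  obtains E where "effective G E" "positive_rank G E" "divisor_degree G E = divisor_degree G D"
proof -
  obtain q where "q \<in> verts G" using verts_nonempty by blast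
  then obtain f where f: "\<forall>u\<in>verts G. of_bool (u = q) \<le> D u - laplacian G f u"
    using assms unfolding positive_rank_iff by blast
  have "effective G (\<lambda>u. D u - laplacian G f u)"
    unfolding effective_def
  proof
    fix u assume "u \<in> verts G"
    then show "0 \<le> D u - laplacian G f u" using f by (cases "u = q") fastforce+
  qed
  then show ?thesis
    using that positive_rank_laplacian[OF assms] divisor_degree_laplacian by blast
qed

section \<open>Effective divisors and edge cuts\<close>

text \<open>A script that turns \<open>D\<close> into an effective divisor sends at least one chip along each edge
  leaving the set on which it is maximal.\<close>

lemma maximal_set_outdegree_le:
  assumes "0 \<le> D u - laplacian G f u" "u \<in> U"
    and "\<And>v. v \<in> U \<Longrightarrow> f v = M" "\<And>v. v \<in> verts G - U \<Longrightarrow> f v < M" "U \<subseteq> verts G"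
  shows "(\<Sum>w\<in>verts G - U. int (count (edges G) {u, w})) \<le> D u"
proof -
  have "(\<Sum>w\<in>verts G - U. int (count (edges G) {u, w})) \<le>
      (\<Sum>w\<in>verts G - U. int (count (edges G) {u, w}) * (f u - f w))"
  proof (rule sum_mono)
    fix w assume "w \<in> verts G - U"
    then have "1 \<le> f u - f w" using assms(2-4) by fastforce
    then show "int (count (edges G) {u, w}) \<le> int (count (edges G) {u, w}) * (f u - f w)"
      using mult_left_mono[of 1 "f u - f w" "int (count (edges G) {u, w})"] by simp
  qed
  also have "\<dots> = laplacian G f u"
    unfolding laplacian_def using finite_verts assms(2,3,5)
    by (intro sum.mono_neutral_left) auto
  finally show ?thesis using assms(1) by simp
qed

lemma cut_size_le_degree:
  assumes "effective G D" "U \<subseteq> verts G"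
    and "\<And>u. u \<in> U \<Longrightarrow> (\<Sum>w\<in>verts G - U. int (count (edges G) {u, w})) \<le> D u"
  shows "int (cut_size G U) \<le> divisor_degree G D"
proof -
  have "int (cut_size G U) \<le> sum D U"
    unfolding cut_size_def of_nat_sum using assms(3) by (rule sum_mono)
  also have "\<dots> \<le> divisor_degree G D"
    unfolding divisor_degree_def using assms finite_verts
    by (intro sum_mono2) (auto simp: effective_def)
  finally show ?thesis .
qed

text \<open>Since \<open>D q = 0\<close>, a script that brings a chip to \<open>q\<close> is not
  constant on the vertices, so the set \<open>U\<close> where it is maximal is proper. The script
  and its maximum are returned too, because a later argument needs its values on
  \<open>U\<close>.\<close>

lemma positive_rank_obtain_cut:
  assumes "positive_rank G D" "effective G D" "q \<in> verts G" "D q = 0"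
  obtains U f M where "U \<subset> verts G" "U \<noteq> {}"
    "\<forall>v\<in>U. f v = M" "\<forall>u\<in>verts G. of_bool (u = q) \<le> D u - laplacian G f u"
    "\<forall>u\<in>U. (\<Sum>w\<in>verts G - U. int (count (edges G) {u, w})) \<le> D u"
    "int (cut_size G U) \<le> divisor_degree G D"
proof -
  obtain f where f: "\<And>u. u \<in> verts G \<Longrightarrow> of_bool (u = q) \<le> D u - laplacian G f u"
    using assms(1,3) unfolding positive_rank_iff by blast
  define M where "M = Max (f ` verts G)"
  define U where "U = {v \<in> verts G. f v = M}"
  have le: "f v \<le> M" if "v \<in> verts G" for v using that finite_verts by (simp add: M_def)
  have "M \<in> f ` verts G" unfolding M_def using finite_verts verts_nonempty by (intro Max_in) auto
  then have ne: "U \<noteq> {}" by (auto simp: U_def)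
  have lt: "f v < M" if "v \<in> verts G - U" for v using that le[of v] by (auto simp: U_def)
  have "U \<noteq> verts G"
  proof
    assume "U = verts G"
    then have "f v = M" if "v \<in> verts G" for v using that by (auto simp: U_def)
    then have "laplacian G f q = 0" using assms(3) by (simp add: laplacian_def)
    then show False using f[OF assms(3)] assms(4) by simp
  qed
  then have U: "U \<subset> verts G" by (auto simp: U_def)
  have eff: "0 \<le> D u - laplacian G f u" if "u \<in> verts G" for u
    using f[OF that] by (auto split: if_splits simp: of_bool_def)
  have out: "(\<Sum>w\<in>verts G - U. int (count (edges G) {u, w})) \<le> D u" if "u \<in> U" for u
    by (rule maximal_set_outdegree_le[where M = M, of D u f])
      (use that U lt eff in \<open>auto simp: U_def\<close>)
  have "int (cut_size G U) \<le> divisor_degree G D"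
    using cut_size_le_degree[OF assms(2) _ out] U by blast
  then show ?thesis using that[OF U ne, of f M] f out by (auto simp: U_def)
qed

lemma effective_obtain_zero:
  assumes "effective G D" "divisor_degree G D < int (card (verts G))"
  obtains q where "q \<in> verts G" "D q = 0"
proof -
  have "\<exists>q\<in>verts G. D q = 0"
  proof (rule ccontr)
    assume "\<not> (\<exists>q\<in>verts G. D q = 0)"
    then have "1 \<le> D u" if "u \<in> verts G" for u
      using that assms(1) unfolding effective_def by (metis int_one_le_iff_zero_less order_less_le)
    then have "int (card (verts G)) \<le> divisor_degree G D"
      using sum_mono[of "verts G" "\<lambda>_. 1" D] by (simp add: divisor_degree_def)
    then show False using assms(2) by simp
  qed
  then show ?thesis using that by blast
qed

text \<open>Edge connectivity bounds the gonality from below, provided that there are enough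
  vertices for a divisor of smaller degree to leave one without chips.\<close>

lemma min_cut_le_degree:
  assumes "positive_rank G D" "k \<le> card (verts G)"
    and "\<And>U. U \<subset> verts G \<Longrightarrow> U \<noteq> {} \<Longrightarrow> k \<le> cut_size G U"
  shows "int k \<le> divisor_degree G D"
proof (rule ccontr)
  assume *: "\<not> ?thesis"
  obtain E where E: "effective G E" "positive_rank G E" "divisor_degree G E = divisor_degree G D"
    using positive_rank_obtain_effective[OF assms(1)] by blast
  then obtain q where "q \<in> verts G" "E q = 0"
    using effective_obtain_zero[of E] * assms(2) by auto
  then obtain U where "U \<subset> verts G" "U \<noteq> {}" "int (cut_size G U) \<le> divisor_degree G E"
    using positive_rank_obtain_cut[OF E(2,1)] by metis
  then show False using assms(3)[of U] E(3) * by linarith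
qed

text \<open>Cuts are bounded from below by exhibiting crossing edges; each pair is oriented out of
  \<open>U\<close>, so no edge is counted twice.\<close>

lemma card_le_cut_size:
  assumes "U \<subseteq> verts G" "P \<subseteq> U \<times> (verts G - U)" "\<And>u w. (u, w) \<in> P \<Longrightarrow> adj G u w"
  shows "card P \<le> cut_size G U"
proof -
  have fin: "finite (U \<times> (verts G - U))"
    using assms(1) finite_verts by (auto intro: finite_subset)
  have "card P = (\<Sum>p\<in>P. 1)" by simp
  also have "\<dots> \<le> (\<Sum>(u, w)\<in>P. count (edges G) {u, w})"
    using assms(3) by (intro sum_mono) (auto simp: adj_def Suc_le_eq)
  also have "\<dots> \<le> (\<Sum>(u, w)\<in>U \<times> (verts G - U). count (edges G) {u, w})"
    by (rule sum_mono2[OF fin assms(2)]) auto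
  also have "\<dots> = cut_size G U"
    unfolding cut_size_def by (rule sum.cartesian_product[symmetric])
  finally show ?thesis .
qed

end

section \<open>Cyclic coordinates on the Harary graph\<close>

lemma verts_harary3 [simp]: "verts (harary3 n) = {1..n}"
  by (simp add: harary3_def circulant_def)

lemma count_edges_harary3: "count (edges (harary3 n)) {u, w} = of_bool (adj (harary3 n) u w)"
proof -
  have c: "count (edges (harary3 n)) {u, w} \<le> 1"
    by (simp add: harary3_def circulant_def count_mset_set')
  show ?thesis
  proof (cases "adj (harary3 n) u w")
    case True
    then have "0 < count (edges (harary3 n)) {u, w}" by (simp add: adj_def)
    then have "count (edges (harary3 n)) {u, w} = 1" using c by linarith
    then show ?thesis using True by simp
  next
    case False
    then show ?thesis by (simp add: adj_def count_eq_zero_iff)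
  qed
qed

lemma adj_commute: "adj G u v \<longleftrightarrow> adj G v u"
  by (simp add: adj_def insert_commute)

text \<open>Zero-based position \<open>j\<close> on the cycle read from the vertex
  \<open>s + 1\<close>, taken modulo \<open>n\<close>; the labels themselves start at 1. By
  rotational symmetry any vertex of interest can be put at position 0.\<close>

definition rot :: "nat \<Rightarrow> nat \<Rightarrow> nat \<Rightarrow> nat" where
  "rot n s j = (s + j) mod n + 1"

lemma rot_in: "n > 0 \<Longrightarrow> rot n s j \<in> {1..n}"
  by (simp add: rot_def Suc_le_eq)

lemma mod_add_less_eq:
  fixes n :: nat
  assumes "j < n"
  shows "(s + j) mod n = (if s mod n + j < n then s mod n + j else s mod n + j - n)"
proof -
  have *: "(s + j) mod n = (s mod n + j) mod n" by (simp add: mod_add_left_eq)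
  have "s mod n < n" using assms by simp
  then have "s mod n + j - n < n" using assms by linarith
  then show ?thesis using * by (simp add: le_mod_geq)
qed

text \<open>When the labels wrap around, their distance is \<open>n - (j - i)\<close> instead of
  \<open>j - i\<close>; the set of offsets is invariant under this reflection.\<close>

lemma adj_rot:
  assumes "even n" "n \<ge> 4" "i < j" "j < n"
  shows "adj (harary3 n) (rot n s i) (rot n s j) \<longleftrightarrow> j - i \<in> {1, n - 1, n div 2}"
proof -
  obtain m where m: "n = 2 * m" using assms(1) by (auto elim: evenE)
  define r where "r = s mod n"
  have r: "r < n" using assms by (simp add: r_def)
  have ij: "rot n s i = (if r + i < n then r + i else r + i - n) + 1"
    "rot n s j = (if r + j < n then r + j else r + j - n) + 1"
    using assms mod_add_less_eq[of i n s] mod_add_less_eq[of j n s] by (simp_all add: rot_def r_def)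
  have "nat \<bar>int (rot n s i) - int (rot n s j)\<bar> = j - i \<or>
      nat \<bar>int (rot n s i) - int (rot n s j)\<bar> = n - (j - i)"
    using r assms(3,4) unfolding ij by (auto split: if_splits)
  moreover have "n - (j - i) \<in> {1, n - 1, n div 2} \<longleftrightarrow> j - i \<in> {1, n - 1, n div 2}"
    using assms m by auto
  ultimately show ?thesis
    using adj_harary3_iff[OF assms(1,2), of "rot n s i" "rot n s j"] rot_in[of n s] assms(2)
    by (metis (no_types, lifting) gr_zeroI not_numeral_le_zero)
qed

lemma inj_on_rot: "inj_on (rot n s) {..<n}"
proof
  fix i j assume ij: "i \<in> {..<n}" "j \<in> {..<n}" "rot n s i = rot n s j"
  then have "[s + i = s + j] (mod n)" by (simp add: rot_def cong_def)
  then have "[i = j] (mod n)" by (simp only: cong_add_lcancel_nat)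
  then show "i = j" using ij(1,2) unfolding cong_def by simp
qed

lemma rot_image:
  assumes "n > 0"
  shows "rot n s ` {..<n} = {1..n}"
proof (rule card_subset_eq)
  show "rot n s ` {..<n} \<subseteq> {1..n}" using rot_in[OF assms] by blast
qed (simp_all add: card_image inj_on_rot)

lemma rot_self:
  assumes "v \<in> {1..n}"
  shows "rot n (v - 1) 0 = v"
  using assms by (auto simp: rot_def)

lemma sum_neighbours_rot:
  fixes h :: "nat \<Rightarrow> int"
  assumes "even n" "n \<ge> 4"
  shows "(\<Sum>w\<in>{1..n}. int (count (edges (harary3 n)) {rot n s 0, w}) * h w)
    = h (rot n s 1) + h (rot n s (n - 1)) + h (rot n s (n div 2))"
proof -
  interpret connected_loopless_multigraph "harary3 n"
    using assms by (rule connected_loopless_harary3)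
  let ?c = "\<lambda>j. int (count (edges (harary3 n)) {rot n s 0, rot n s j})"
  have n0: "0 < n" using assms by simp
  have "(\<Sum>w\<in>{1..n}. int (count (edges (harary3 n)) {rot n s 0, w}) * h w)
      = (\<Sum>j<n. ?c j * h (rot n s j))"
    unfolding rot_image[OF n0, of s, symmetric] by (simp add: sum.reindex inj_on_rot)
  also have "\<dots> = (\<Sum>j\<in>{1, n - 1, n div 2}. h (rot n s j))"
  proof (rule sum.mono_neutral_cong_right)
    show "\<forall>j\<in>{..<n} - {1, n - 1, n div 2}. ?c j * h (rot n s j) = 0"
    proof
      fix j assume j: "j \<in> {..<n} - {1, n - 1, n div 2}"
      then show "?c j * h (rot n s j) = 0"
        using adj_rot[OF assms, of 0 j s] by (cases "j = 0") (auto simp: count_edges_harary3)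
    qed
  next
    fix j assume "j \<in> {1, n - 1, n div 2}"
    then show "?c j * h (rot n s j) = h (rot n s j)"
      using adj_rot[OF assms, of 0 j s] assms by (auto simp: count_edges_harary3)
  qed (use assms in auto)
  also have "\<dots> = h (rot n s 1) + h (rot n s (n - 1)) + h (rot n s (n div 2))"
    using assms by auto
  finally show ?thesis .
qed

lemma degree_harary3:
  assumes "even n" "n \<ge> 4" "v \<in> {1..n}"
  shows "(\<Sum>w\<in>{1..n}. int (count (edges (harary3 n)) {v, w})) = 3"
  using sum_neighbours_rot[OF assms(1,2), of "v - 1" "\<lambda>_. 1"] rot_self[OF assms(3)] by simp

lemma degree_harary3_diff:
  assumes "even n" "n \<ge> 4" "v \<in> {1..n}"
  shows "(\<Sum>w\<in>{1..n} - {v}. int (count (edges (harary3 n)) {v, w})) = 3"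
proof -
  interpret connected_loopless_multigraph "harary3 n"
    using assms by (intro connected_loopless_harary3)
  have "(\<Sum>w\<in>{1..n} - {v}. int (count (edges (harary3 n)) {v, w}))
      = (\<Sum>w\<in>{1..n}. int (count (edges (harary3 n)) {v, w}))"
    by (rule sum.mono_neutral_left) auto
  then show ?thesis using degree_harary3[OF assms] by simp
qed

lemma laplacian_harary3_rot:
  assumes "even n" "n \<ge> 4"
  shows "laplacian (harary3 n) f (rot n s 0)
    = 3 * f (rot n s 0) - f (rot n s 1) - f (rot n s (n - 1)) - f (rot n s (n div 2))"
  unfolding laplacian_def verts_harary3 using sum_neighbours_rot[OF assms] by simp

text \<open>If \<open>v\<close> stands at a position \<open>j\<close> seen from \<open>w\<close>
  with \<open>1 < j < n - 1\<close>, then \<open>j - 1\<close> and \<open>n - 1 - j\<close> are each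
  1 or \<open>n div 2\<close>, and their sum is \<open>n - 2\<close>. The possible sums 2,
  \<open>n div 2 + 1\<close> and \<open>n\<close> give \<open>n - 2\<close> only for
  \<open>n = 4\<close> or \<open>n = 6\<close>.\<close>

lemma common_neighbours_harary3:
  assumes "even n" "n \<ge> 8" "v \<in> {1..n}" "w \<in> {1..n}"
    and "\<And>u. u \<in> {1..n} \<Longrightarrow> adj (harary3 n) w u \<Longrightarrow> adj (harary3 n) v u"
  shows "w = v"
proof -
  have n4: "n \<ge> 4" using assms by simp
  interpret connected_loopless_multigraph "harary3 n"
    using assms n4 by (intro connected_loopless_harary3)
  obtain m where m: "n = 2 * m" using assms(1) by (auto elim: evenE)
  define s where "s = w - 1"
  have w: "w = rot n s 0" using rot_self[OF assms(4)] by (simp add: s_def)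
  obtain j where j: "j < n" "v = rot n s j"
    using rot_image[of n s] assms(2,3) by fastforce
  have "adj (harary3 n) w (rot n s 1)" "adj (harary3 n) w (rot n s (n - 1))"
    using adj_rot[OF assms(1) n4, of 0 _ s] assms(2) unfolding w by auto
  then have *: "adj (harary3 n) (rot n s j) (rot n s 1)" "adj (harary3 n) (rot n s j) (rot n s (n - 1))"
    using assms(2,5) rot_in[of n s] j(2) by auto
  have irrefl: "\<not> adj (harary3 n) x x" for x
    using count_edges_same[of x] by (simp add: adj_def flip: count_eq_zero_iff)
  have "j = 0"
  proof (rule ccontr)
    assume "j \<noteq> 0"
    \<comment> \<open>At either of these positions, \<open>v\<close> would be adjacent to
      itself.\<close>
    moreover have "j \<noteq> 1" "j \<noteq> n - 1" using * irrefl by metis+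
    ultimately have b: "1 < j" "j < n - 1" using j(1) by auto
    then have "j - 1 \<in> {1, n - 1, n div 2}" "n - 1 - j \<in> {1, n - 1, n div 2}"
      using * adj_rot[OF assms(1) n4, of 1 j s] adj_rot[OF assms(1) n4, of j "n - 1" s] j(1)
      by (simp_all add: adj_commute)
    then show False using b m assms(2) by auto
  qed
  then show ?thesis using w j by simp
qed

section \<open>Edge cuts of the Harary graph\<close>

text \<open>If \<open>U\<close> splits into several arcs of the cycle, four cycle edges cross the
  cut. If it is a single arc, two cycle edges cross, and since both sides have at least two
  vertices, so do two chords between opposite vertices.\<close>

lemma cut_size_harary3_ge_4:
  assumes "even n" "n \<ge> 4" "U \<subseteq> {1..n}" "2 \<le> card U" "2 \<le> card ({1..n} - U)"
  shows "4 \<le> cut_size (harary3 n) U"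
proof -
  interpret connected_loopless_multigraph "harary3 n"
    using assms by (intro connected_loopless_harary3)
  obtain m where m: "n = 2 * m" "m \<ge> 2" using assms(1,2) by (auto elim!: evenE)
  have n0: "n > 0" using assms by simp
  have finU: "finite U" using assms(3) finite_subset by blast
  \<comment> \<open>Start the cyclic order where it enters \<open>U\<close>.\<close>
  obtain s where s: "rot n s 0 \<in> U" "rot n s (n - 1) \<notin> U"
  proof -
    have "{1..n} - U \<noteq> {}" "U \<noteq> {}" using assms(4,5) by (metis card.empty not_numeral_le_zero)+
    then obtain x y where x: "x \<in> {1..n} - U" and y: "y \<in> U" by blast
    define r where "r = x - 1"
    have r: "rot n r 0 \<notin> U" using x rot_self[of x n] by (simp add: r_def)
    have "y \<in> rot n r ` {..<n}" using y assms(3) rot_image[OF n0] by blast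
    then have ex: "\<exists>j. rot n r j \<in> U" using y by blast
    define j where "j = (LEAST j. rot n r j \<in> U)"
    have j: "rot n r j \<in> U" unfolding j_def using ex by (rule LeastI_ex)
    then obtain k where k: "j = Suc k" using r by (cases j) auto
    have "rot n r k \<notin> U" using not_less_Least[of k "\<lambda>j. rot n r j \<in> U"] k j_def by auto
    \<comment> \<open>Going \<open>n - 1\<close> steps forward is going one step back.\<close>
    moreover have "rot n (r + j) (n - 1) = rot n r k"
    proof -
      have "r + j + (n - 1) = (r + k) + n" using n0 k by simp
      then show ?thesis unfolding rot_def by (simp only: mod_add_self2)
    qed
    ultimately show ?thesis using j that[of "r + j"] by (simp add: rot_def)
  qed
  define X where "X i \<longleftrightarrow> rot n s i \<in> U" for i
  \<comment> \<open>It suffices to list four pairs of positions, the first in \<open>U\<close> and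
    the second outside; injectivity of \<open>rot\<close> keeps them distinct.\<close>
  have four: "4 \<le> cut_size (harary3 n) U"
    if P: "P \<subseteq> {..<n} \<times> {..<n}" "card P = 4"
      "\<And>i j. (i, j) \<in> P \<Longrightarrow> X i \<and> \<not> X j \<and> nat \<bar>int i - int j\<bar> \<in> {1, n - 1, n div 2}" for P
  proof -
    let ?P = "map_prod (rot n s) (rot n s) ` P"
    have "inj_on (map_prod (rot n s) (rot n s)) P"
      by (rule inj_on_subset[OF map_prod_inj_on[OF inj_on_rot inj_on_rot] P(1)])
    then have "card ?P = 4" using P(2) by (simp add: card_image)
    moreover have "card ?P \<le> cut_size (harary3 n) U"
    proof (rule card_le_cut_size)
      show "?P \<subseteq> U \<times> (verts (harary3 n) - U)"
        using P(3) rot_in[OF n0, of s] by (auto simp: X_def)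
      fix u w assume "(u, w) \<in> ?P"
      then obtain i j where ij: "(i, j) \<in> P" "u = rot n s i" "w = rot n s j" by auto
      have d: "nat \<bar>int i - int j\<bar> \<in> {1, n - 1, n div 2}" "i < n" "j < n"
        using P(1,3) ij(1) by auto
      then have "i < j \<or> j < i" using assms(2) by (cases i j rule: linorder_cases) auto
      then show "adj (harary3 n) u w"
      proof
        assume "i < j"
        then show ?thesis using adj_rot[OF assms(1,2), of i j s] d ij by (auto simp: nat_diff_distrib)
      next
        assume "j < i"
        then show ?thesis using adj_rot[OF assms(1,2), of j i s] d ij
          by (auto simp: nat_diff_distrib adj_commute)
      qed
    qed (use assms(3) in auto)
    ultimately show ?thesis by simp
  qed
  have X0: "X 0" and Xn: "\<not> X (n - 1)" using s by (auto simp: X_def)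
  \<comment> \<open>\<open>a\<close> is where the order first leaves \<open>U\<close>, so the
    positions below \<open>a\<close> form its first arc.\<close>
  define a where "a = (LEAST j. \<not> X j)"
  have a: "\<not> X a" unfolding a_def using Xn by (rule LeastI)
  have a_min: "X j" if "j < a" for j using not_less_Least that unfolding a_def by blast
  have a_le: "a \<le> n - 1" unfolding a_def using Xn by (rule Least_le)
  have a0: "0 < a" using a X0 by (cases a) auto
  show ?thesis
  proof (cases "\<exists>c>a. c < n \<and> X c")
    case False
    have XU: "card U = card {j. j < n \<and> X j}" "card ({1..n} - U) = card {j. j < n \<and> \<not> X j}"
    proof -
      have "U = rot n s ` {j. j < n \<and> X j}" "{1..n} - U = rot n s ` {j. j < n \<and> \<not> X j}"
        using rot_image[OF n0, of s] assms(3) by (auto simp: X_def)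
      moreover have "inj_on (rot n s) {j. j < n \<and> Q j}" for Q
        by (rule inj_on_subset[OF inj_on_rot]) auto
      ultimately show "card U = card {j. j < n \<and> X j}" "card ({1..n} - U) = card {j. j < n \<and> \<not> X j}"
        by (metis card_image)+
    qed
    have iff: "X j \<longleftrightarrow> j < a" if "j < n" for j
      using that False a a_min by (metis linorder_neqE_nat)
    have "{j. j < n \<and> X j} = {..<a}" "{j. j < n \<and> \<not> X j} = {a..<n}"
      using iff a_le n0 by auto
    then have a2: "2 \<le> a" "a \<le> n - 2" using XU assms(4,5) by auto
    show ?thesis
    proof (cases "a \<le> m")
      case True
      \<comment> \<open>The chords start at the two ends 0 and \<open>a - 1\<close> of the arc,
        which is short enough for the opposite positions to lie beyond it.\<close>
      show ?thesis
        by (rule four[of "{(0, n - 1), (a - 1, a), (0, m), (a - 1, a - 1 + m)}"])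
          (use True a2 m iff in auto)
    next
      case False
      \<comment> \<open>Now the complementary arc is the short one. Its ends \<open>a\<close> and
        \<open>n - 1\<close> are opposite to \<open>a - m\<close> and \<open>m - 1\<close>.\<close>
      show ?thesis
        by (rule four[of "{(0, n - 1), (a - 1, a), (a - m, a), (m - 1, n - 1)}"])
          (use False a2 m iff in auto)
    qed
  next
    case True
    \<comment> \<open>\<open>c\<close> is where the order enters \<open>U\<close> again and
      \<open>d\<close> where it leaves \<open>U\<close> once more; \<open>d\<close> exists because
      the last position is outside.\<close>
    define c where "c = (LEAST c. a < c \<and> X c)"
    obtain c' where c': "a < c' \<and> X c'" "c' < n" using True by blast
    have c: "a < c" "X c" using LeastI[of "\<lambda>c. a < c \<and> X c", OF c'(1)] by (simp_all add: c_def)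
    have c_min: "\<not> X j" if "a < j" "j < c" for j
      using not_less_Least[of j "\<lambda>c. a < c \<and> X c"] that unfolding c_def by blast
    have "c \<le> c'" unfolding c_def using c'(1) by (rule Least_le)
    have cn: "c < n - 1" using c c'(2) \<open>c \<le> c'\<close> Xn
      by (metis Suc_diff_1 le_less_trans less_antisym n0)
    define d where "d = (LEAST d. c < d \<and> \<not> X d)"
    have n1: "c < n - 1 \<and> \<not> X (n - 1)" using cn Xn by simp
    have d: "c < d" "\<not> X d" using LeastI[of "\<lambda>d. c < d \<and> \<not> X d", OF n1] by (simp_all add: d_def)
    have d_min: "X j" if "c < j" "j < d" for j
      using not_less_Least[of j "\<lambda>d. c < d \<and> \<not> X d"] that unfolding d_def by blast
    have dn: "d \<le> n - 1" unfolding d_def using n1 by (rule Least_le)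
    have "\<not> X (c - 1)" using c c_min[of "c - 1"] a by (cases "c - 1 = a") auto
    moreover have "X (d - 1)" using d d_min[of "d - 1"] c by (cases "d - 1 = c") auto
    moreover have "X (a - 1)" using a_min a0 by simp
    moreover have "(c, c - 1) \<noteq> (d - 1, d)" using d(1) by auto
    ultimately show ?thesis
      by (intro four[of "{(0, n - 1), (a - 1, a), (c, c - 1), (d - 1, d)}"])
        (use a0 a c d dn cn X0 Xn in auto)
  qed
qed

lemma cut_size_harary3_cases:
  assumes "even n" "n \<ge> 4" "U \<subset> {1..n}" "U \<noteq> {}" "cut_size (harary3 n) U \<le> 3"
  obtains v where "v \<in> {1..n}" "U = {v} \<or> U = {1..n} - {v}"
proof -
  have fin: "finite U" "finite ({1..n} - U)" using assms(3) finite_subset by auto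
  have pos: "card U \<noteq> 0" "card ({1..n} - U) \<noteq> 0" using assms(3,4) fin by auto
  have "\<not> (2 \<le> card U \<and> 2 \<le> card ({1..n} - U))"
    using cut_size_harary3_ge_4[OF assms(1,2), of U] assms(3,5) by auto
  then have "card U = 1 \<or> card ({1..n} - U) = 1" using pos by linarith
  then obtain v where "U = {v} \<or> {1..n} - U = {v}" by (auto simp: card_1_singleton_iff)
  then have "v \<in> {1..n} \<and> (U = {v} \<or> U = {1..n} - {v})" using assms(3) by blast
  then show ?thesis using that by blast
qed

text \<open>A smaller cut would separate one vertex from the rest, but then its size is the degree
  of that vertex, which is 3.\<close>

lemma cut_size_harary3_ge_3:
  assumes "even n" "n \<ge> 4" "U \<subset> {1..n}" "U \<noteq> {}"
  shows "3 \<le> cut_size (harary3 n) U"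
proof (rule ccontr)
  assume *: "\<not> ?thesis"
  then obtain v where v: "v \<in> {1..n}" "U = {v} \<or> U = {1..n} - {v}"
    using cut_size_harary3_cases[OF assms] by auto
  have "int (cut_size (harary3 n) U) = (\<Sum>w\<in>{1..n} - {v}. int (count (edges (harary3 n)) {v, w}))"
    using v(2)
  proof
    assume "U = {1..n} - {v}"
    moreover have "{1..n} - ({1..n} - {v}) = {v}" using v(1) by auto
    ultimately show ?thesis by (simp add: cut_size_def insert_commute)
  qed (simp add: cut_size_def)
  then show False using * degree_harary3_diff[OF assms(1,2) v(1)] by simp
qed

lemma size_incident_harary3:
  assumes "even n" "n \<ge> 4" "v \<in> {1..n}"
  shows "size {#e \<in># edges (harary3 n). v \<in> e#} = 3"
proof -
  interpret connected_loopless_multigraph "harary3 n"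
    using assms by (intro connected_loopless_harary3)
  show ?thesis
    using degree_eq_sum_count[of v] degree_harary3_diff[OF assms] assms(3)
    by (simp flip: of_nat_sum)
qed

section \<open>Divisors of degree at most three\<close>

text \<open>By the cut bound, only single vertices or complements of single vertices can be fired
  from an effective divisor of degree at most \<open>3\<close>, so some vertex \<open>w\<close> carries all chips or each
  of its neighbours carries one chip.\<close>

lemma positive_rank_neighbours:
  assumes "even n" "n \<ge> 4" "positive_rank (harary3 n) D" "effective (harary3 n) D"
    and "divisor_degree (harary3 n) D \<le> 3"
  obtains w where "w \<in> {1..n}"
    "positive_rank (harary3 n) (\<lambda>u. int (count (edges (harary3 n)) {w, u}))"
proof -
  define G where "G = harary3 n"
  interpret connected_loopless_multigraph G
    unfolding G_def using assms by (intro connected_loopless_harary3)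
  have V: "verts G = {1..n}" by (simp add: G_def)
  have D: "positive_rank G D" "effective G D" "sum D (verts G) \<le> 3"
    using assms by (simp_all add: G_def divisor_degree_def)
  \<comment> \<open>As \<open>D\<close> has degree at most 3, a pointwise lower bound of degree 3
    already determines it.\<close>
  have eq: "D u = E u" if "\<And>u. u \<in> verts G \<Longrightarrow> E u \<le> D u" "sum E (verts G) = 3" "u \<in> verts G" for E u
  proof -
    have "(\<Sum>u\<in>verts G. D u - E u) = 0"
      using that(1,2) D(3) sum_mono[of "verts G" E D] by (simp add: sum_subtractf)
    then show ?thesis
      using sum_nonneg_eq_0_iff[of "verts G" "\<lambda>u. D u - E u"] that(1,3) finite_verts by simp
  qed
  obtain q where q: "q \<in> verts G" "D q = 0"
    using effective_obtain_zero[OF D(2)] D(3) assms(2) by (auto simp: V divisor_degree_def)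
  obtain U f M where U: "U \<subset> verts G" "U \<noteq> {}" "int (cut_size G U) \<le> divisor_degree G D"
    and out: "\<forall>u\<in>U. (\<Sum>w\<in>verts G - U. int (count (edges G) {u, w})) \<le> D u"
    by (rule positive_rank_obtain_cut[OF D(1,2) q])
  have "cut_size G U \<le> 3" using U(3) D(3) by (simp add: divisor_degree_def)
  then obtain v where v: "v \<in> {1..n}" "U = {v} \<or> U = {1..n} - {v}"
    using cut_size_harary3_cases[OF assms(1,2), of U] U(1,2) V by (auto simp: G_def)
  from v(2) have "positive_rank G (\<lambda>u. int (count (edges G) {v, u}))"
  proof
    assume U: "U = {v}"
    have "3 \<le> D v"
      using bspec[OF out, of v] degree_harary3_diff[OF assms(1,2) v(1)] U V by (simp add: G_def)
    then have "3 * of_bool (u = v) \<le> D u" if "u \<in> verts G" for u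
      using that D(2) by (auto simp: effective_def)
    moreover have "(\<Sum>u\<in>verts G. 3 * of_bool (u = v)) = (3::int)"
      using v(1) V by (simp add: of_bool_def if_distrib cong: if_cong)
    ultimately have Dv: "D u = 3 * of_bool (u = v)" if "u \<in> verts G" for u
      using eq[of "\<lambda>u. 3 * of_bool (u = v)" u] that by blast
    \<comment> \<open>Firing \<open>v\<close> once turns its three chips into one chip on each
      neighbour.\<close>
    have "positive_rank G (\<lambda>u. D u - laplacian G (\<lambda>x. of_bool (x = v)) u)"
      by (rule positive_rank_laplacian[OF D(1)])
    then show ?thesis
      using v(1) size_incident_harary3[OF assms(1,2) v(1)]
      by (subst (asm) positive_rank_cong[where E = "\<lambda>u. int (count (edges G) {v, u})"])
        (auto simp: Dv V laplacian_of_bool insert_commute simp flip: G_def)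
  next
    assume U: "U = {1..n} - {v}"
    \<comment> \<open>Each vertex of \<open>U\<close> has at least as many chips as edges to
      \<open>v\<close>, so \<open>D\<close> dominates the neighbourhood of \<open>v\<close>.\<close>
    have "verts G - U = {v}" using U V v(1) by blast
    then have "int (count (edges G) {v, u}) \<le> D u" if "u \<in> verts G" for u
      using that out D(2) U V
      by (cases "u = v") (auto simp: effective_def insert_commute)
    then have Dv: "D u = int (count (edges G) {v, u})" if "u \<in> verts G" for u
      using eq[of "\<lambda>u. int (count (edges G) {v, u})" u] that degree_harary3[OF assms(1,2) v(1)]
      by (simp add: V flip: G_def)
    show ?thesis by (rule positive_rank_cong[THEN iffD1, OF Dv D(1)])
  qed
  then show ?thesis using that v(1) by (simp add: G_def)
qed

text \<open>The cut argument is applied again, to the neighbourhood of \<open>w\<close>. No vertex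
  has three chips there, so a script can only be maximal off a single vertex \<open>v\<close>, and
  the chips force \<open>v = w\<close>. Such a script does not change the value at a vertex
  \<open>q\<close> that is neither \<open>w\<close> nor adjacent to it.\<close>

lemma positive_rank_harary3_degree_ge_4:
  assumes "even n" "n \<ge> 8" "positive_rank (harary3 n) D"
  shows "4 \<le> divisor_degree (harary3 n) D"
proof (rule ccontr)
  assume deg: "\<not> ?thesis"
  have n4: "n \<ge> 4" using assms(2) by simp
  define G where "G = harary3 n"
  interpret connected_loopless_multigraph G
    unfolding G_def using assms(1) n4 by (rule connected_loopless_harary3)
  have V: "verts G = {1..n}" by (simp add: G_def)
  obtain E where E: "effective G E" "positive_rank G E" "divisor_degree G E = divisor_degree G D"
    using positive_rank_obtain_effective[of D] assms(3) unfolding G_def by blast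
  have "divisor_degree G E \<le> 3" using E(3) deg by (simp add: G_def)
  then obtain w where w: "w \<in> {1..n}" and pr: "positive_rank G (\<lambda>u. int (count (edges G) {w, u}))"
    using positive_rank_neighbours[OF assms(1) n4, of E] E(1,2) unfolding G_def by blast
  define c where "c u v = int (count (edges G) {u, v})" for u v
  have c_adj: "c u v = of_bool (adj (harary3 n) u v)" for u v
    by (simp add: c_def G_def count_edges_harary3)
  have deg3: "sum (c w) (verts G) = 3"
    using degree_harary3[OF assms(1) n4 w] by (simp add: c_def V flip: G_def)
  \<comment> \<open>The extra chip on \<open>w\<close> ensures that the vertex found without chips
    differs from \<open>w\<close>; the degree 4 is still below \<open>n\<close>.\<close>
  have "effective G (\<lambda>u. c w u + of_bool (u = w))" by (simp add: effective_def c_def)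
  moreover have "divisor_degree G (\<lambda>u. c w u + of_bool (u = w)) = 4"
    using w deg3 by (simp add: divisor_degree_def sum.distrib V of_bool_def)
  ultimately obtain q where "q \<in> verts G" "c w q + of_bool (q = w) = 0"
    using effective_obtain_zero[of "\<lambda>u. c w u + of_bool (u = w)"] assms(2) by (auto simp: V)
  moreover have "c w q \<ge> 0" by (simp add: c_def)
  ultimately have q: "q \<in> verts G" "c w q = 0" "q \<noteq> w" by (cases "q = w"; simp)+
  have eff: "effective G (c w)" by (simp add: effective_def c_def)
  have pr': "positive_rank G (c w)" using pr by (simp add: c_def[abs_def])
  obtain U f M where U: "U \<subset> verts G" "U \<noteq> {}"
    and fM: "\<forall>v\<in>U. f v = M"
    and f: "\<forall>u\<in>verts G. of_bool (u = q) \<le> c w u - laplacian G f u"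
    and out: "\<forall>u\<in>U. (\<Sum>x\<in>verts G - U. c u x) \<le> c w u"
    and cut: "int (cut_size G U) \<le> divisor_degree G (c w)"
    by (rule positive_rank_obtain_cut[folded c_def, OF pr' eff q(1,2)])
  have "cut_size G U \<le> 3" using cut deg3 by (simp add: divisor_degree_def)
  then obtain v where v: "v \<in> {1..n}" "U = {v} \<or> U = {1..n} - {v}"
    using cut_size_harary3_cases[OF assms(1) n4, of U] U(1,2) V by (auto simp: G_def)
  from v(2) show False
  proof
    assume U: "U = {v}"
    then have "3 \<le> c w v"
      using bspec[OF out, of v] degree_harary3_diff[OF assms(1) n4 v(1)] by (simp add: V c_def flip: G_def)
    then show False by (cases "adj (harary3 n) w v") (simp_all add: c_adj)
  next
    assume U: "U = {1..n} - {v}"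
    have diff: "verts G - U = {v}" using U V v(1) by blast
    have "adj (harary3 n) w u" if "u \<in> {1..n}" "adj (harary3 n) v u" for u
    proof -
      have "c u v = 1" using that(2) by (simp add: c_adj adj_commute)
      moreover have "u \<noteq> v" using calculation by (auto simp: c_def)
      ultimately have "1 \<le> c w u" using bspec[OF out, of u] that(1) U diff by simp
      then show ?thesis by (cases "adj (harary3 n) w u") (simp_all add: c_adj)
    qed
    then have vw: "v = w" using common_neighbours_harary3[OF assms(1,2) w v(1)] by blast
    have "laplacian G f q = 0" unfolding laplacian_def
    proof (rule sum.neutral, rule ballI)
      fix x assume x: "x \<in> verts G"
      show "int (count (edges G) {q, x}) * (f q - f x) = 0"
      proof (cases "x = w")
        case True
        then show ?thesis using q(2) by (simp add: c_def insert_commute)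
      next
        case False
        then show ?thesis using fM x q V U vw by simp
      qed
    qed
    then show False using bspec[OF f q(1)] q(2) by simp
  qed
qed

section \<open>Upper bound by four chips\<close>

text \<open>Residues modulo \<open>m\<close> name the rungs, which are the pairs of opposite
  vertices; a step along the cycle leads to the next rung.\<close>

lemma rot_mod_half: "rot (2 * m) s j mod m = (s + j + 1) mod m"
proof -
  have "rot (2 * m) s j mod m = ((s + j) mod (2 * m) mod m + 1) mod m"
    by (simp add: rot_def mod_Suc_eq)
  then show ?thesis by (simp add: mod_mod_cancel mod_Suc_eq)
qed

text \<open>\<open>F t\<close> is the number of firings of both ends of rung \<open>t\<close>, up to sign: a trapezoid on the cycle
  of \<open>m\<close> rungs with kinks at \<open>0\<close>, \<open>j\<close> and \<open>m - j\<close>. Its effect on two chips at each end of rung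
  \<open>0\<close> is to move one pair to rung \<open>j\<close> and the other to rung \<open>m - j\<close>.\<close>

lemma rung_script:
  fixes m t j :: nat
  defines "F \<equiv> \<lambda>x. - int (min (min x (m - x)) (min j (m - j)))"
  assumes "m \<ge> 2" "t < m" "j < m"
  shows "of_bool (t = j) \<le> (if t = 0 then 2 else 0) -
    (2 * F t - F (if t + 1 < m then t + 1 else 0) - F (if t = 0 then m - 1 else t - 1))"
proof -
  \<comment> \<open>\<open>K\<close> is the height of the trapezoid; passing to integers removes the
    truncated subtractions.\<close>
  define K where "K = min (int j) (int m - int j)"
  have F: "F x = - min (min (int x) (int m - int x)) K" if "x < m" for x
    using that assms(4) by (simp add: F_def K_def of_nat_diff)
  consider "t = 0" | "t \<noteq> 0" "t + 1 < m" | "t \<noteq> 0" "t + 1 = m" using assms(3) by linarith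
  then show ?thesis
  proof cases
    case 1
    then show ?thesis using assms F[of 0] F[of 1] F[of "m - 1"] by (auto simp: K_def of_nat_diff)
  next
    case 2
    then have "F t = - min (min (int t) (int m - int t)) K"
      "F (t + 1) = - min (min (int t + 1) (int m - int t - 1)) K"
      "F (t - 1) = - min (min (int t - 1) (int m - int t + 1)) K"
      using F[of t] F[of "t + 1"] F[of "t - 1"] by (auto simp: of_nat_diff algebra_simps)
    moreover have "of_bool (t = j) \<le> - (2 * - min (min (int t) (int m - int t)) K
        - - min (min (int t + 1) (int m - int t - 1)) K - - min (min (int t - 1) (int m - int t + 1)) K)"
      unfolding K_def min_def by (cases "t = j") (simp_all split: if_split)
    ultimately show ?thesis using 2 by simp
  next
    case 3
    then have "m = t + 1" by simp
    then show ?thesis using 3 assms F[of t] F[of 0] F[of "t - 1"]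
      by (auto simp: K_def of_nat_diff min_def)
  qed
qed

text \<open>The script is constant on each rung, so the chord terms cancel and the Laplacian becomes
  a second difference along the cycle of rungs.\<close>

lemma positive_rank_rung:
  assumes "m \<ge> 2"
  shows "positive_rank (harary3 (2 * m)) (\<lambda>v. if v mod m = 0 then 2 else 0)"
proof -
  define G where "G = harary3 (2 * m)"
  interpret connected_loopless_multigraph G
    unfolding G_def using assms by (intro connected_loopless_harary3) auto
  have V: "verts G = {1..2 * m}" by (simp add: G_def)
  have "positive_rank G (\<lambda>v. if v mod m = 0 then 2 else 0)"
    unfolding positive_rank_iff
  proof
    fix q assume "q \<in> verts G"
    define j where "j = q mod m"
    have j: "j < m" using assms by (simp add: j_def)
    define F where "F t = - int (min (min t (m - t)) (min j (m - j)))" for t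
    have "of_bool (u = q) \<le> (if u mod m = 0 then 2 else 0) - laplacian G (\<lambda>v. F (v mod m)) u"
      if "u \<in> verts G" for u
    proof -
      define t where "t = u mod m"
      have t: "t < m" using assms by (simp add: t_def)
      have u: "u = rot (2 * m) (u - 1) 0" using rot_self[of u "2 * m"] that V by simp
      have u1: "1 \<le> u" using that V by simp
      have "rot (2 * m) (u - 1) 1 mod m = (u + 1) mod m"
        "rot (2 * m) (u - 1) m mod m = (u + m) mod m"
        unfolding rot_mod_half using u1 by simp_all
      moreover have "rot (2 * m) (u - 1) (2 * m - 1) mod m = (u + (m - 1)) mod m"
      proof -
        have "u - 1 + (2 * m - 1) + 1 = (u + (m - 1)) + m" using u1 assms by simp
        then show ?thesis unfolding rot_mod_half by (simp only: mod_add_self2)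
      qed
      moreover have "(u + 1) mod m = (if t + 1 < m then t + 1 else 0)"
        "(u + m) mod m = t" "(u + (m - 1)) mod m = (if t = 0 then m - 1 else t - 1)"
        using mod_add_less_eq[of 1 m u, folded t_def] mod_add_less_eq[of "m - 1" m u, folded t_def]
          assms t by (auto simp: t_def[symmetric] split: if_splits)
      ultimately have r: "rot (2 * m) (u - 1) 1 mod m = (if t + 1 < m then t + 1 else 0)"
        "rot (2 * m) (u - 1) m mod m = t"
        "rot (2 * m) (u - 1) (2 * m - 1) mod m = (if t = 0 then m - 1 else t - 1)"
        by (simp_all only:)
      have "laplacian G (\<lambda>v. F (v mod m)) (rot (2 * m) (u - 1) 0) =
          2 * F t - F (if t + 1 < m then t + 1 else 0) - F (if t = 0 then m - 1 else t - 1)"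
        unfolding G_def using assms laplacian_harary3_rot[of "2 * m" "\<lambda>v. F (v mod m)" "u - 1"]
        by (simp add: r[simplified] u[symmetric, simplified] t_def[symmetric])
      then have lap: "laplacian G (\<lambda>v. F (v mod m)) u =
          2 * F t - F (if t + 1 < m then t + 1 else 0) - F (if t = 0 then m - 1 else t - 1)"
        using u by simp
      have "of_bool (t = j) \<le> (if t = 0 then 2 else 0) -
          (2 * F t - F (if t + 1 < m then t + 1 else 0) - F (if t = 0 then m - 1 else t - 1))"
        unfolding F_def by (rule rung_script[OF assms t j])
      \<comment> \<open>Both ends of rung \<open>j\<close> receive a chip, and \<open>q\<close> is
        one of them.\<close>
      moreover have "of_bool (u = q) \<le> (of_bool (t = j) :: int)" by (auto simp: t_def j_def)
      ultimately show ?thesis unfolding lap t_def by linarith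
    qed
    then show "\<exists>f. \<forall>u\<in>verts G. of_bool (u = q) \<le> (if u mod m = 0 then 2 else 0) - laplacian G f u"
      by blast
  qed
  then show ?thesis by (simp add: G_def)
qed

text \<open>The chips lie on \<open>m\<close> and \<open>2 * m\<close>, the only multiples of
  \<open>m\<close> among the vertices.\<close>

lemma divisor_degree_rung:
  assumes "m > 0"
  shows "divisor_degree (harary3 (2 * m)) (\<lambda>v. if v mod m = 0 then 2 else 0) = 4"
proof -
  have "v = m \<or> v = 2 * m" if v: "v \<in> {1..2 * m}" "v mod m = 0" for v
  proof -
    obtain k where k: "v = m * k" using v(2) by (auto simp: mod_eq_0_iff_dvd)
    then have "k \<le> 2" "k \<noteq> 0" using v(1) assms by (auto simp: mult.commute)
    then have "k = 1 \<or> k = 2" by auto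
    then show ?thesis using k by auto
  qed
  then have "(\<Sum>v\<in>{1..2 * m}. if v mod m = 0 then 2 else 0) = (\<Sum>v\<in>{m, 2 * m}. (2::int))"
    using assms by (intro sum.mono_neutral_cong_right) auto
  then show ?thesis using assms by (simp add: divisor_degree_def)
qed

section \<open>Upper bound by three chips\<close>

text \<open>For \<open>n = 4\<close> the graph is complete, which leaves only \<open>q = n\<close>.
  For \<open>n = 6\<close> it is complete bipartite between odd and even labels.\<close>

lemma twins_harary3:
  assumes "n = 4 \<or> n = 6" "q \<in> {1..n}" "u \<in> {1..n}" "\<not> adj (harary3 n) n q"
  shows "adj (harary3 n) q u \<longleftrightarrow> adj (harary3 n) n u"
proof -
  have n: "even n" "n \<ge> 4" "n \<in> {1..n}" using assms(1) by auto
  have "q \<le> 6" "u \<le> 6" "q \<noteq> 0" "u \<noteq> 0" using assms(1-3) by auto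
  then have "q \<in> {1, 2, 3, 4, 5, 6}" "u \<in> {1, 2, 3, 4, 5, 6}" by auto
  then show ?thesis
    using assms unfolding adj_harary3_iff[OF n(1,2) assms(2,3)] adj_harary3_iff[OF n(1,2,3) assms(3)]
      adj_harary3_iff[OF n(1,2,3) assms(2)]
    by auto
qed

lemma positive_rank_neighbours_small:
  assumes "n = 4 \<or> n = 6"
  shows "positive_rank (harary3 n) (\<lambda>u. int (count (edges (harary3 n)) {n, u}))"
proof -
  have n: "even n" "n \<ge> 4" "n \<in> {1..n}" using assms by auto
  define G where "G = harary3 n"
  interpret connected_loopless_multigraph G
    unfolding G_def using n by (intro connected_loopless_harary3)
  have V: "verts G = {1..n}" by (simp add: G_def)
  have "positive_rank G (\<lambda>u. int (count (edges G) {n, u}))"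
    unfolding positive_rank_iff
  proof
    fix q assume q: "q \<in> verts G"
    show "\<exists>f. \<forall>u\<in>verts G. of_bool (u = q) \<le> int (count (edges G) {n, u}) - laplacian G f u"
    proof (cases "adj G n q")
      case True
      then have "\<forall>u\<in>verts G. of_bool (u = q) \<le> int (count (edges G) {n, u}) - laplacian G (\<lambda>_. 0) u"
        by (auto simp: laplacian_def G_def count_edges_harary3)
      then show ?thesis by blast
    next
      case False
      \<comment> \<open>Firing \<open>q\<close> backwards collects one chip from each of its
        neighbours, which are exactly those of \<open>n\<close>.\<close>
      have "of_bool (u = q) \<le> int (count (edges G) {n, u}) - laplacian G (\<lambda>x. - of_bool (x = q)) u"
        if "u \<in> verts G" for u
      proof (cases "u = q")
        case True
        then show ?thesis
          using size_incident_harary3[OF n(1,2), of q] q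
          by (simp add: laplacian_uminus laplacian_of_bool V flip: G_def)
      next
        case uq: False
        have "count (edges G) {u, q} = count (edges G) {n, u}"
          using twins_harary3[OF assms, of q u] q that False
          by (simp add: V G_def count_edges_harary3 adj_commute[of _ u])
        then show ?thesis using q uq by (simp add: laplacian_uminus laplacian_of_bool)
      qed
      then show ?thesis by blast
    qed
  qed
  then show ?thesis by (simp add: G_def)
qed

section \<open>Computation of the gonality\<close>

text \<open>The integers are not well-ordered, so \<open>LEAST\<close> is evaluated by a lower bound
  that \<open>D\<close> attains.\<close>

lemma gonality_eqI:
  assumes "positive_rank G D" "divisor_degree G D = d"
    and "\<And>E. positive_rank G E \<Longrightarrow> d \<le> divisor_degree G E"
  shows "gonality G = d"
  unfolding gonality_def by (rule Least_equality) (use assms in auto)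

theorem theorem3p5:
  fixes n :: nat
  assumes "even n" and "n \<ge> 4"
  shows "gonality (harary3 n) = (if n \<le> 6 then 3 else 4)"
proof (cases "n \<le> 6")
  case True
  then have small: "n = 4 \<or> n = 6" using assms by (auto elim!: evenE)
  interpret connected_loopless_multigraph "harary3 n"
    using assms by (rule connected_loopless_harary3)
  have "gonality (harary3 n) = 3"
  proof (rule gonality_eqI)
    show "positive_rank (harary3 n) (\<lambda>u. int (count (edges (harary3 n)) {n, u}))"
      by (rule positive_rank_neighbours_small[OF small])
    show "divisor_degree (harary3 n) (\<lambda>u. int (count (edges (harary3 n)) {n, u})) = 3"
      using degree_harary3[OF assms, of n] assms(2) by (simp add: divisor_degree_def)
    show "3 \<le> divisor_degree (harary3 n) E" if "positive_rank (harary3 n) E" for E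
      using min_cut_le_degree[OF that, of 3] cut_size_harary3_ge_3[OF assms] assms(2) by simp
  qed
  then show ?thesis using True by simp
next
  case False
  obtain m where m: "n = 2 * m" using assms(1) by (auto elim: evenE)
  have "gonality (harary3 n) = 4"
  proof (rule gonality_eqI)
    show "positive_rank (harary3 n) (\<lambda>v. if v mod m = 0 then 2 else 0)"
      unfolding m by (rule positive_rank_rung) (use m assms(2) in simp)
    show "divisor_degree (harary3 n) (\<lambda>v. if v mod m = 0 then 2 else 0) = 4"
      unfolding m by (rule divisor_degree_rung) (use m assms(2) in simp)
    show "4 \<le> divisor_degree (harary3 n) E" if "positive_rank (harary3 n) E" for E
      by (rule positive_rank_harary3_degree_ge_4) (use that m False in auto)
  qed
  then show ?thesis using False by simp
qed

end
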